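(* For the secretary ranking problem with $m=n$ positions, there exists an algorithm whose output ranking has $O(n\sqrt{n})$ inversions in expectation.
   Context: Secretary ranking problem: there are $n$ elements with distinct values from a totally ordered set, and $m\ge n$ positions $1,\dots,m$ (here $m=n$). The elements arrive online in a uniformly random order; $a_t$ denotes the element arriving at time $t$, and $\mathrm{rk}(a)\in[n]$ denotes the true rank of element $a$ in the total order. At time $t$ the algorithm only knows the outcomes of pairwise comparisons among $a_1,\dots,a_t$, and must irrevocably assign $a_t$ a position $\pi(a_t)\in[m]$ not assigned to any earlier element. The cost is the number of inversions $|\{(i,j): (\pi(a_i)-\pi(a_j))(\mathrm{rk}(a_i)-\mathrm{rk}(a_j))<0\}|$. Expectations are over the random arrival order and the algorithm's internal randomness. *)

theory Defs
  imports "HOL-Probability.Probability" "HOL-Combinatorics.Multiset_Permutations"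
begin

text \<open>
  The instance is a finite set \<open>S\<close> of elements of a linear order. An arrival order is a list
  \<open>xs\<close> enumerating \<open>S\<close> without repetition: times are list indices, counted from 0, so
  \<open>xs ! t\<close> is the element called $a_{t+1}$ with times counted from 1. Positions and ranks are
  counted from 1.
\<close>

text \<open>Everything an algorithm has learnt once the elements \<open>ys\<close> have arrived; the indices are
  arrival times, so the values themselves stay hidden.\<close>

definition comparisons :: "'a::linorder list \<Rightarrow> nat rel" where
  "comparisons ys = {(i, j). i < length ys \<and> j < length ys \<and> ys ! i < ys ! j}"

text \<open>A deterministic online rule \<open>f\<close> maps the time \<open>t\<close> and the comparisons among the elements
  that arrived at times \<open>0, \<dots>, t\<close> to the position given to the element arriving at time \<open>t\<close>. Its
  own earlier decisions are functions of earlier comparisons and hence need not be an argument.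
  A randomized algorithm draws a deterministic rule at the start, independently of the arrival
  order.\<close>

type_synonym online_rule = "nat \<Rightarrow> nat rel \<Rightarrow> nat"

type_synonym randomized_rule = "online_rule pmf"

definition assigned_position :: "online_rule \<Rightarrow> 'a::linorder list \<Rightarrow> nat \<Rightarrow> nat" where
  "assigned_position f xs t = f t (comparisons (take (Suc t) xs))"

definition online_ranking_algorithm :: "nat \<Rightarrow> 'a::linorder set \<Rightarrow> randomized_rule \<Rightarrow> bool" where
  "online_ranking_algorithm m S A \<longleftrightarrow>
     (\<forall>f \<in> set_pmf A. \<forall>xs \<in> permutations_of_set S. \<forall>t < card S.
        assigned_position f xs t \<in> {1..m} - assigned_position f xs ` {..<t})"

definition rk :: "'a::linorder set \<Rightarrow> 'a \<Rightarrow> nat" where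
  "rk S a = card {b \<in> S. b \<le> a}"

text \<open>Ordered pairs are counted, so each discordant pair of elements contributes 2.\<close>

definition inversions :: "online_rule \<Rightarrow> 'a::linorder list \<Rightarrow> nat" where
  "inversions f xs =
     card {(i, j). i < length xs \<and> j < length xs \<and>
       (int (assigned_position f xs i) - int (assigned_position f xs j)) *
       (int (rk (set xs) (xs ! i)) - int (rk (set xs) (xs ! j))) < 0}"

definition expected_inversions :: "'a::linorder set \<Rightarrow> randomized_rule \<Rightarrow> real" where
  "expected_inversions S A =
     measure_pmf.expectation (pair_pmf (pmf_of_set (permutations_of_set S)) A)
       (\<lambda>(xs, f). real (inversions f xs))"

end

theory Submission imports Defs begin

text \<open>
  With $t$ counted from 0, let $r_t \in \{0,\dots,t\}$ be the relative rank of the $t$-th arrival and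
  add noise $u_t$ uniform on $\{0,\dots,n-t-1\}$, so that $v_t = r_t (n-t) + u_t$ is uniform
  below $(t+1)(n-t)$, independently for all $t$. The element gets the free position of index
  $\lfloor v_t/(t+1) \rfloor$ among the $n-t$ free ones, so the positions form a uniformly random sequence.

  The true rank is obtained from $\lfloor v_t/(n-t) \rfloor$ by the same process run backwards in time.
  Hence, for a threshold $p$, the rank and the position of the element lie on different sides of $p$
  exactly if $v_t/((t+1)(n-t))$ separates two fractions: that of positions below $p$ among the free
  positions, and that of ranks below $p$ among the first $t+1$ arrivals. Both are independent of
  $v_t$ and are martingales around $p/n$ (in forward and backward time) with standard deviations
  $O(1/\sqrt{n-t})$ and $O(1/\sqrt{t+1})$. Summing over $t$ and $p$ bounds the footrule distance
  $\sum_t |\pi(a_t) - \mathrm{rk}(a_t)|$ by $O(n\sqrt n)$, and this distance bounds the number of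
  inversions.
\<close>

subsection \<open>Sequential removal\<close>

text \<open>\<open>x\<close> need not lie in \<open>A\<close>: the same count is the 0-based rank of
  a member and the number of members under a threshold.\<close>

definition below :: "'a::linorder set \<Rightarrow> 'a \<Rightarrow> nat" where
  "below A x = card {y \<in> A. y < x}"

lemma below_less_iff:
  assumes "finite A" "x \<in> A"
  shows "below A x < below A p \<longleftrightarrow> x < p"
proof
  assume "x < p"
  then have "{y \<in> A. y < x} \<subset> {y \<in> A. y < p}"
    using assms by auto
  then show "below A x < below A p"
    unfolding below_def using assms by (intro psubset_card_mono) auto
next
  show "x < p" if "below A x < below A p"
  proof (rule ccontr)
    assume "\<not> x < p"
    then have "below A p \<le> below A x"
      unfolding below_def using assms by (intro card_mono) auto
    then show False
      using that by simp
  qed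
qed

lemma bij_betw_below:
  assumes "finite A"
  shows "bij_betw (below A) A {..<card A}"
proof -
  have inj: "inj_on (below A) A"
    using below_less_iff[OF assms] by (intro inj_onI) (metis less_irrefl linorder_neqE)
  moreover have "below A ` A \<subseteq> {..<card A}"
    unfolding below_def using assms by (auto intro!: psubset_card_mono)
  ultimately show ?thesis
    by (metis bij_betw_def card_image card_lessThan card_subset_eq finite_lessThan)
qed

lemma below_image:
  assumes "strict_mono_on A f" "x \<in> A"
  shows "below (f ` A) (f x) = below A x"
proof -
  have "{y \<in> f ` A. y < f x} = f ` {y \<in> A. y < x}"
    using assms by (auto simp: strict_mono_on_less)
  moreover have "inj_on f {y \<in> A. y < x}"
    using assms(1) by (rule inj_on_subset[OF strict_mono_on_imp_inj_on]) auto
  ultimately show ?thesis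
    by (simp add: below_def card_image)
qed

lemma rk_eq_Suc_below:
  assumes "finite S" "x \<in> S"
  shows "rk S x = Suc (below S x)"
proof -
  have "{b \<in> S. b \<le> x} = insert x {b \<in> S. b < x}"
    using assms by auto
  then show ?thesis
    using assms by (simp add: rk_def below_def)
qed

definition nth_least :: "'a::linorder set \<Rightarrow> nat \<Rightarrow> 'a" where
  "nth_least A = inv_into A (below A)"

lemma nth_least_in: "finite A \<Longrightarrow> k < card A \<Longrightarrow> nth_least A k \<in> A"
  unfolding nth_least_def using bij_betw_below[of A]
  by (metis bij_betw_imp_surj_on inv_into_into lessThan_iff)

lemma below_nth_least: "finite A \<Longrightarrow> k < card A \<Longrightarrow> below A (nth_least A k) = k"
  unfolding nth_least_def using bij_betw_below[of A]
  by (metis bij_betw_imp_surj_on f_inv_into_f lessThan_iff)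

lemma nth_least_below: "finite A \<Longrightarrow> x \<in> A \<Longrightarrow> nth_least A (below A x) = x"
  unfolding nth_least_def using bij_betw_below[of A]
  by (simp add: bij_betw_def)

lemma nth_least_less_iff:
  "finite A \<Longrightarrow> k < card A \<Longrightarrow> nth_least A k < p \<longleftrightarrow> k < below A p"
  by (metis below_less_iff below_nth_least nth_least_in)

text \<open>Unlike in the definitions of the problem, positions and ranks are counted from 0 here.\<close>

primrec free :: "nat \<Rightarrow> (nat \<Rightarrow> nat) \<Rightarrow> nat \<Rightarrow> nat set" where
  "free n k 0 = {..<n}"
| "free n k (Suc s) = free n k s - {nth_least (free n k s) (k s)}"

definition slot :: "nat \<Rightarrow> (nat \<Rightarrow> nat) \<Rightarrow> nat \<Rightarrow> nat" where
  "slot n k s = nth_least (free n k s) (k s)"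

lemma finite_free [simp]: "finite (free n k s)"
  by (induction s) auto

text \<open>This takes the place of independence: choices from time \<open>s\<close> on can be
  resampled without disturbing the free set at \<open>s\<close>.\<close>

lemma free_cong: "(\<And>i. i < s \<Longrightarrow> k i = k' i) \<Longrightarrow> free n k s = free n k' s"
  by (induction s) auto

lemma slot_cong: "(\<And>i. i \<le> s \<Longrightarrow> k i = k' i) \<Longrightarrow> slot n k s = slot n k' s"
  unfolding slot_def using free_cong[of s k k' n] by simp

lemma free_antimono: "s \<le> t \<Longrightarrow> free n k t \<subseteq> free n k s"
  by (induction t) (auto simp: le_Suc_eq)

lemma card_free:
  assumes "\<And>i. i < n \<Longrightarrow> k i < n - i" "s \<le> n"
  shows "card (free n k s) = n - s"
  using assms(2)
proof (induction s)
  case (Suc s)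
  then show ?case
    using nth_least_in[of "free n k s" "k s"] assms(1)[of s] by simp
qed simp

lemma slot_in_free:
  assumes "\<And>i. i < n \<Longrightarrow> k i < n - i" "s < n"
  shows "slot n k s \<in> free n k s"
  unfolding slot_def using assms card_free[of n k s] by (intro nth_least_in) auto

lemma slot_less:
  assumes "\<And>i. i < n \<Longrightarrow> k i < n - i" "s < n"
  shows "slot n k s < n"
  using slot_in_free[of n k s, OF assms] free_antimono[of 0 s n k] by auto

lemma slot_neq:
  assumes "\<And>i. i < n \<Longrightarrow> k i < n - i" "s < t" "t < n"
  shows "slot n k t \<noteq> slot n k s"
  using slot_in_free[of n k t, OF assms(1,3)] free_antimono[of "Suc s" t n k] assms(2)
  by (auto simp: slot_def)

lemma inj_on_slot:
  assumes "\<And>i. i < n \<Longrightarrow> k i < n - i"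
  shows "inj_on (slot n k) {..<n}"
  by (intro inj_onI) (metis assms lessThan_iff linorder_neqE_nat slot_neq)

lemma slot_less_iff:
  assumes "\<And>i. i < n \<Longrightarrow> k i < n - i" "s < n"
  shows "slot n k s < p \<longleftrightarrow> k s < below (free n k s) p"
  unfolding slot_def using assms card_free[of n k s] by (intro nth_least_less_iff) auto

text \<open>Only the removal of a position under \<open>p\<close> lowers the count, and the count is
  positive then, so the truncated subtraction is exact.\<close>

lemma below_free_Suc:
  assumes "\<And>i. i < n \<Longrightarrow> k i < n - i" "s < n"
  shows "below (free n k (Suc s)) p =
    below (free n k s) p - (if k s < below (free n k s) p then 1 else 0)"
proof -
  have "{y \<in> free n k (Suc s). y < p} =
      (if slot n k s < p then {y \<in> free n k s. y < p} - {slot n k s} else {y \<in> free n k s. y < p})"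
    by (auto simp: slot_def)
  then show ?thesis
    using slot_in_free[of n k s, OF assms] slot_less_iff[of n k s p, OF assms]
    by (simp add: below_def)
qed

lemma below_le_card: "finite A \<Longrightarrow> below A p \<le> card A"
  unfolding below_def by (intro card_mono) auto

subsection \<open>Averages\<close>

text \<open>Expectation under the uniform distribution on a finite set, kept as a plain sum; the
  link to \<open>measure_pmf\<close> is made in
  \<open>expected_inversions_algorithm\<close>.\<close>

definition average :: "'b set \<Rightarrow> ('b \<Rightarrow> real) \<Rightarrow> real" where
  "average A f = (\<Sum>x\<in>A. f x) / real (card A)"

lemma average_mono: "(\<And>x. x \<in> A \<Longrightarrow> f x \<le> g x) \<Longrightarrow> average A f \<le> average A g"
  unfolding average_def by (intro divide_right_mono sum_mono) auto

lemma average_cong: "(\<And>x. x \<in> A \<Longrightarrow> f x = g x) \<Longrightarrow> average A f = average A g"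
  unfolding average_def by simp

lemma average_add: "average A (\<lambda>x. f x + g x) = average A f + average A g"
  unfolding average_def by (simp add: sum.distrib add_divide_distrib)

lemma average_cmult: "average A (\<lambda>x. c * f x) = c * average A f"
  unfolding average_def by (simp add: sum_distrib_left)

lemma average_const: "finite A \<Longrightarrow> A \<noteq> {} \<Longrightarrow> average A (\<lambda>x. c) = c"
  unfolding average_def by simp

lemma average_sum: "average A (\<lambda>x. \<Sum>i\<in>I. f i x) = (\<Sum>i\<in>I. average A (f i))"
  unfolding average_def by (subst sum.swap) (simp add: sum_divide_distrib)

lemma average_reindex:
  assumes "bij_betw h A B"
  shows "average B f = average A (\<lambda>x. f (h x))"
  unfolding average_def using assms
  by (simp add: bij_betw_same_card sum.reindex_bij_betw)

text \<open>Exchanging coordinate \<open>t\<close> with a fresh value is an involution of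
  \<open>PiE I B \<times> B t\<close>, so both sides sum over the same pairs. It acts as
  conditioning on all other coordinates.\<close>

lemma average_PiE_resample:
  assumes "finite I" "\<And>i. i \<in> I \<Longrightarrow> finite (B i) \<and> B i \<noteq> {}" "t \<in> I"
  shows "average (PiE I B) F = average (PiE I B) (\<lambda>w. average (B t) (\<lambda>v. F (w(t := v))))"
proof -
  have "(\<Sum>(w, v)\<in>PiE I B \<times> B t. F w) = (\<Sum>(w, v)\<in>PiE I B \<times> B t. F (w(t := v)))"
    using assms(3)
    by (intro sum.reindex_bij_witness[of _ "\<lambda>(w, v). (w(t := v), w t)" "\<lambda>(w, v). (w(t := v), w t)"])
      (auto simp: PiE_iff extensional_def)
  then have "real (card (B t)) * (\<Sum>w\<in>PiE I B. F w) = (\<Sum>w\<in>PiE I B. \<Sum>v\<in>B t. F (w(t := v)))"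
    by (simp add: sum.cartesian_product[symmetric] sum_distrib_left)
  moreover have "card (B t) > 0"
    using assms by (simp add: card_gt_0_iff)
  ultimately have "(\<Sum>w\<in>PiE I B. F w) = (\<Sum>w\<in>PiE I B. \<Sum>v\<in>B t. F (w(t := v))) / real (card (B t))"
    by (simp add: field_simps)
  then show ?thesis
    by (simp add: average_def sum_divide_distrib)
qed

subsection \<open>Misplacement under uniform codes\<close>

text \<open>The bound is invariant under replacing \<open>t\<close> by \<open>n - 1 - t\<close>, so
  time reversal maps codes to codes.\<close>

definition codes :: "nat \<Rightarrow> (nat \<Rightarrow> nat) set" where
  "codes n = (\<Pi>\<^sub>E t\<in>{..<n}. {..<Suc t * (n - t)})"

text \<open>For a code this is the index of the chosen free position. For the reversed code at
  \<open>n - 1 - t\<close> the divisor is \<open>n - t\<close>, which extracts the relative rank of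
  arrival \<open>t\<close> instead.\<close>

definition quot :: "(nat \<Rightarrow> nat) \<Rightarrow> nat \<Rightarrow> nat" where
  "quot w t = w t div Suc t"

definition reversed :: "nat \<Rightarrow> (nat \<Rightarrow> nat) \<Rightarrow> nat \<Rightarrow> nat" where
  "reversed n w = (\<lambda>t\<in>{..<n}. w (n - 1 - t))"

lemma finite_codes: "finite (codes n)"
  unfolding codes_def by (intro finite_PiE) auto

lemma codes_nonempty: "codes n \<noteq> {}"
  unfolding codes_def by (auto simp: PiE_eq_empty_iff lessThan_empty_iff simp del: mult_Suc)

lemma reversed_codes: "w \<in> codes n \<Longrightarrow> reversed n w \<in> codes n"
proof -
  assume w: "w \<in> codes n"
  have "w (n - 1 - t) < Suc t * (n - t)" if "t < n" for t
  proof -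
    have "w (n - 1 - t) < Suc (n - 1 - t) * (n - (n - 1 - t))"
      using w that unfolding codes_def by (auto dest!: PiE_mem[of _ _ _ "n - 1 - t"] simp del: mult_Suc)
    moreover have "Suc (n - 1 - t) = n - t" "n - (n - 1 - t) = Suc t"
      using that by auto
    ultimately show ?thesis
      by (simp only: mult.commute)
  qed
  then show ?thesis
    by (auto simp: codes_def reversed_def simp del: mult_Suc)
qed

lemma bij_betw_reversed: "bij_betw (reversed n) (codes n) (codes n)"
proof (rule bij_betw_byWitness[where f' = "reversed n"])
  have "reversed n (reversed n w) = w" if "w \<in> codes n" for w
    using that by (auto simp: codes_def reversed_def PiE_iff extensional_def restrict_def fun_eq_iff)
  then show "\<forall>w\<in>codes n. reversed n (reversed n w) = w" "\<forall>w\<in>codes n. reversed n (reversed n w) = w"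
    by auto
qed (auto intro: reversed_codes)

lemma quot_less: "w \<in> codes n \<Longrightarrow> t < n \<Longrightarrow> quot w t < n - t"
  unfolding codes_def quot_def
  by (auto simp: PiE_iff div_less_iff_less_mult mult.commute simp del: mult_Suc mult_Suc_right)

lemma average_codes_resample:
  assumes "t < n"
  shows "average (codes n) F =
    average (codes n) (\<lambda>w. average {..<Suc t * (n - t)} (\<lambda>v. F (w(t := v))))"
  unfolding codes_def using assms
  by (intro average_PiE_resample) (auto simp: lessThan_empty_iff)

lemma average_div_less:
  fixes x y :: real
  assumes "m \<le> b" "0 < a" "0 < b"
  shows "average {..<a * b} (\<lambda>v. if v div a < m then x else y) =
    real m / real b * x + (1 - real m / real b) * y"
proof -
  have "m * a \<le> a * b"
    using assms by (simp add: mult.commute)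
  then have "{..<a * b} = {..<m * a} \<union> {m * a..<a * b}"
    by (simp only: ivl_disj_un)
  then have "(\<Sum>v<a * b. if v < m * a then x else y) = (\<Sum>v<m * a. x) + (\<Sum>v\<in>{m * a..<a * b}. y)"
    by (simp add: sum.union_disjoint[where A = "{..<m * a}"] ivl_disj_int)
  also have "\<dots> = real (m * a) * x + (real (a * b) - real (m * a)) * y"
    using \<open>m * a \<le> a * b\<close> by (simp add: of_nat_diff)
  finally show ?thesis
    using assms by (simp add: average_def div_less_iff_less_mult field_simps)
qed

text \<open>The two conditions say \<open>v < x * a\<close> and \<open>v < y * b\<close>. They
  disagree exactly on the interval between these bounds, whose share of \<open>a * b\<close> is the
  difference of the fractions.\<close>

lemma average_div_less_neq:
  assumes "x \<le> b" "y \<le> a" "0 < a" "0 < b"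
  shows "average {..<a * b} (\<lambda>v. of_bool ((v div a < x) \<noteq> (v div b < y))) =
    \<bar>real x / real b - real y / real a\<bar>"
proof -
  let ?l = "min (x * a) (y * b)" and ?u = "max (x * a) (y * b)"
  have "?u \<le> a * b"
    using assms by (simp add: mult.commute)
  then have "{?l..<?u} \<subseteq> {..<a * b}"
    by (meson atLeastLessThan_iff lessThan_iff less_le_trans subsetI)
  moreover have "{v. (v div a < x) \<noteq> (v div b < y)} = {?l..<?u}"
    using assms by (auto simp: div_less_iff_less_mult less_max_iff_disj min_le_iff_disj)
  ultimately have "{..<a * b} \<inter> {v. (v div a < x) \<noteq> (v div b < y)} = {?l..<?u}"
    by (simp add: Int_absorb1)
  then have "(\<Sum>v<a * b. of_bool ((v div a < x) \<noteq> (v div b < y))) = real (?u - ?l)"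
    by (simp add: sum.If_cases of_bool_def)
  also have "\<dots> = \<bar>real (x * a) - real (y * b)\<bar>"
    by (cases "x * a \<le> y * b") (simp_all add: of_nat_diff flip: of_nat_mult)
  finally have "average {..<a * b} (\<lambda>v. of_bool ((v div a < x) \<noteq> (v div b < y))) =
      \<bar>real (x * a) - real (y * b)\<bar> / \<bar>real (a * b)\<bar>"
    by (simp add: average_def)
  also have "\<dots> = \<bar>(real (x * a) - real (y * b)) / real (a * b)\<bar>"
    by (rule abs_divide[symmetric])
  also have "(real (x * a) - real (y * b)) / real (a * b) = real x / real b - real y / real a"
    using assms by (simp add: field_simps)
  finally show ?thesis .
qed

section \<open>Concentration of the fraction of free positions below a threshold\<close>

definition low_fraction :: "nat \<Rightarrow> nat \<Rightarrow> nat \<Rightarrow> (nat \<Rightarrow> nat) \<Rightarrow> real" where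
  "low_fraction n p s w = real (below (free n (quot w) s) p) / real (n - s)"

text \<open>The fraction of free positions below \<open>p\<close> is a martingale; a step adds variance
  \<open>q * (1 - q) / (n - Suc s)\<^sup>2\<close>, where \<open>q\<close> is the current fraction.\<close>

lemma low_fraction_step:
  assumes "w \<in> codes n" "Suc s < n"
  shows "average {..<Suc s * (n - s)} (\<lambda>v. (low_fraction n p (Suc s) (w(s := v)) - c)\<^sup>2)
    \<le> (low_fraction n p s w - c)\<^sup>2 + 1 / (4 * (real (n - Suc s))\<^sup>2)"
proof -
  define m where "m = below (free n (quot w) s) p"
  define g where "g = real (n - Suc s)"
  define q where "q = real m / (g + 1)"
  have g: "g \<ge> 1" "real (n - s) = g + 1"
    using assms by (auto simp: g_def of_nat_diff)
  have m: "m \<le> n - s"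
    unfolding m_def using below_le_card[of "free n (quot w) s" p] card_free[of n "quot w" s]
      quot_less[OF assms(1)] assms(2) by simp
  have low: "low_fraction n p (Suc s) (w(s := v)) =
      (if v div Suc s < m then (real m - 1) / g else real m / g)"
    if v: "v < Suc s * (n - s)" for v
  proof -
    have w': "w(s := v) \<in> codes n"
      using assms v by (auto simp: codes_def PiE_iff extensional_def simp del: mult_Suc)
    have "free n (quot (w(s := v))) s = free n (quot w) s"
      by (rule free_cong) (simp add: quot_def)
    then have "below (free n (quot (w(s := v))) (Suc s)) p = m - (if v div Suc s < m then 1 else 0)"
      using below_free_Suc[of n "quot (w(s := v))" s p] quot_less[OF w'] assms(2)
      by (simp add: m_def quot_def)
    then show ?thesis
      by (auto simp: low_fraction_def g_def of_nat_diff)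
  qed
  have "average {..<Suc s * (n - s)} (\<lambda>v. (low_fraction n p (Suc s) (w(s := v)) - c)\<^sup>2)
      = average {..<Suc s * (n - s)} (\<lambda>v. if v div Suc s < m then ((real m - 1) / g - c)\<^sup>2
          else (real m / g - c)\<^sup>2)"
    using low by (intro average_cong) (auto simp del: mult_Suc)
  also have "\<dots> = q * ((real m - 1) / g - c)\<^sup>2 + (1 - q) * (real m / g - c)\<^sup>2"
    using average_div_less[of m "n - s" "Suc s"] m assms(2) g by (simp add: q_def del: mult_Suc)
  also have "\<dots> = (q - c)\<^sup>2 + q * (1 - q) / g\<^sup>2"
  proof -
    have mq: "real m = q * (g + 1)"
      using g by (simp add: q_def)
    have "(real m - 1) / g = q - (1 - q) / g" "real m / g = q + q / g"
      using g by (simp_all add: mq field_simps)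
    \<comment> \<open>With \<open>h\<close> in place of \<open>1 / g\<close> the bias-variance
      identity is polynomial.\<close>
    moreover have "q * (q - (1 - q) * h - c)\<^sup>2 + (1 - q) * (q + q * h - c)\<^sup>2 = (q - c)\<^sup>2 + q * (1 - q) * h\<^sup>2" for h
      by algebra
    from this[of "1 / g"] have "q * (q - (1 - q) / g - c)\<^sup>2 + (1 - q) * (q + q / g - c)\<^sup>2 = (q - c)\<^sup>2 + q * (1 - q) / g\<^sup>2"
      by (simp add: power_divide)
    ultimately show ?thesis
      by simp
  qed
  also have "\<dots> \<le> (q - c)\<^sup>2 + (1 / 4) / g\<^sup>2"
  proof -
    have "q * (1 - q) \<le> 1 / 4"
      using zero_le_power2[of "q - 1 / 2"] by (simp add: power2_eq_square algebra_simps)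
    then show ?thesis
      by (intro add_left_mono divide_right_mono) auto
  qed
  finally show ?thesis
    using g by (simp add: q_def m_def low_fraction_def g_def)
qed

text \<open>The bound is chosen to absorb one step: passing from \<open>1 / (2 * (g + 1))\<close> to
  \<open>1 / (2 * g)\<close> gains \<open>1 / (2 * g * (g + 1))\<close>, which covers the added
  \<open>1 / (4 * g\<^sup>2)\<close> as soon as \<open>g \<ge> 1\<close>.\<close>

lemma low_fraction_variance:
  assumes "p \<le> n" "s < n"
  shows "average (codes n) (\<lambda>w. (low_fraction n p s w - real p / real n)\<^sup>2) \<le> 1 / (2 * real (n - s))"
  using assms(2)
proof (induction s)
  case 0
  \<comment> \<open>Before any removal the fraction is exactly \<open>p / n\<close>, because
    \<open>p \<le> n\<close>.\<close>
  have "{y. y < n \<and> y < p} = {..<p}"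
    using assms(1) by auto
  then show ?case
    by (simp add: low_fraction_def below_def average_def)
next
  case (Suc s)
  define g where "g = real (n - Suc s)"
  have g: "g \<ge> 1" "real (n - s) = g + 1"
    using Suc.prems by (auto simp: g_def of_nat_diff)
  let ?c = "real p / real n"
  have "average (codes n) (\<lambda>w. (low_fraction n p (Suc s) w - ?c)\<^sup>2) =
      average (codes n) (\<lambda>w. average {..<Suc s * (n - s)}
        (\<lambda>v. (low_fraction n p (Suc s) (w(s := v)) - ?c)\<^sup>2))"
    using Suc.prems by (intro average_codes_resample) simp
  also have "\<dots> \<le> average (codes n) (\<lambda>w. (low_fraction n p s w - ?c)\<^sup>2 + 1 / (4 * g\<^sup>2))"
    unfolding g_def using Suc.prems by (intro average_mono low_fraction_step) auto
  also have "\<dots> \<le> 1 / (2 * (g + 1)) + 1 / (4 * g\<^sup>2)"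
    using Suc g by (simp add: average_add average_const finite_codes codes_nonempty)
  also have "\<dots> \<le> 1 / (2 * g)"
  proof -
    have "1 / (2 * g) - (1 / (2 * (g + 1)) + 1 / (4 * g\<^sup>2)) = (g - 1) / (4 * g\<^sup>2 * (g + 1))"
      using g by (simp add: divide_simps power2_eq_square) (simp add: algebra_simps)
    moreover have "\<dots> \<ge> 0"
      using g by simp
    ultimately show ?thesis
      by simp
  qed
  finally show ?case
    by (simp add: g_def)
qed

text \<open>A weighted AM-GM inequality replaces Cauchy-Schwarz. The weight \<open>r\<close>, of the
  order of the inverse standard deviation, yields \<open>1 / (4 * r) + 1 / (2 * r)\<close>.\<close>

lemma low_fraction_deviation:
  assumes "p \<le> n" "s < n"
  shows "average (codes n) (\<lambda>w. \<bar>low_fraction n p s w - real p / real n\<bar>) \<le> 1 / sqrt (real (n - s))"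
proof -
  define r where "r = sqrt (real (n - s))"
  have r: "r > 0" "r\<^sup>2 = real (n - s)"
    using assms by (auto simp: r_def)
  have am_gm: "\<bar>x\<bar> \<le> r / 2 * x\<^sup>2 + 1 / (2 * r)" for x
  proof -
    have "0 \<le> (r * \<bar>x\<bar> - 1)\<^sup>2 / (2 * r)"
      using r by simp
    also have "\<dots> = r / 2 * x\<^sup>2 + 1 / (2 * r) - \<bar>x\<bar>"
      using r by (simp add: power2_diff power_mult_distrib field_simps power2_eq_square)
    finally show ?thesis
      by simp
  qed
  have "average (codes n) (\<lambda>w. \<bar>low_fraction n p s w - real p / real n\<bar>) \<le>
      average (codes n) (\<lambda>w. r / 2 * (low_fraction n p s w - real p / real n)\<^sup>2 + 1 / (2 * r))"
    by (intro average_mono am_gm)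
  also have "\<dots> \<le> r / 2 * (1 / (2 * r\<^sup>2)) + 1 / (2 * r)"
    unfolding average_add average_cmult average_const[OF finite_codes codes_nonempty]
    using low_fraction_variance[OF assms] r by (intro add_right_mono mult_left_mono) auto
  also have "\<dots> \<le> 1 / r"
    using r(1) by (simp add: field_simps power2_eq_square)
  finally show ?thesis
    by (simp add: r_def)
qed

text \<open>Whether the element at time \<open>t\<close> is misplaced with respect to the threshold \<open>p\<close> depends on the
  code at \<open>t\<close>, compared with two thresholds: one depends only on earlier codes, the other only on
  later ones.\<close>

lemma average_crossing:
  assumes "p \<le> n" "t < n"
  shows "average (codes n) (\<lambda>w. of_bool ((slot n (quot w) t < p) \<noteq>
      (slot n (quot (reversed n w)) (n - 1 - t) < p)))
    \<le> 1 / sqrt (real (n - t)) + 1 / sqrt (real (Suc t))"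
proof -
  let ?c = "real p / real n" and ?t = "n - 1 - t"
  have t: "?t < n" "n - ?t = Suc t" "Suc ?t = n - t"
    using assms by auto
  have "average (codes n) (\<lambda>w. of_bool ((slot n (quot w) t < p) \<noteq>
        (slot n (quot (reversed n w)) ?t < p)))
    = average (codes n) (\<lambda>w. average {..<Suc t * (n - t)} (\<lambda>v.
        of_bool ((slot n (quot (w(t := v))) t < p) \<noteq>
          (slot n (quot (reversed n (w(t := v)))) ?t < p))))"
    using assms by (intro average_codes_resample)
  also have "\<dots> = average (codes n) (\<lambda>w. \<bar>low_fraction n p t w - low_fraction n p ?t (reversed n w)\<bar>)"
  proof (rule average_cong)
    fix w assume w: "w \<in> codes n"
    let ?x = "below (free n (quot w) t) p" and ?y = "below (free n (quot (reversed n w)) ?t) p"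
    have "?x \<le> n - t" "?y \<le> Suc t"
      using below_le_card[of "free n (quot w) t" p] card_free[of n "quot w" t]
        below_le_card[of "free n (quot (reversed n w)) ?t" p] card_free[of n "quot (reversed n w)" ?t]
        quot_less[OF w] quot_less[OF reversed_codes[OF w]] assms(2) t by simp_all
    moreover have "(slot n (quot (w(t := v))) t < p) = (v div Suc t < ?x)"
        "(slot n (quot (reversed n (w(t := v)))) ?t < p) = (v div (n - t) < ?y)"
      if v: "v < Suc t * (n - t)" for v
    proof -
      have w': "w(t := v) \<in> codes n"
        using w assms v by (auto simp: codes_def PiE_iff extensional_def simp del: mult_Suc)
      have "free n (quot (w(t := v))) t = free n (quot w) t"
        by (rule free_cong) (simp add: quot_def)
      then show "(slot n (quot (w(t := v))) t < p) = (v div Suc t < ?x)"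
        using slot_less_iff[of n "quot (w(t := v))" t p] quot_less[OF w'] assms(2)
        by (simp add: quot_def)
      \<comment> \<open>The reversed process before \<open>?t\<close> reads only codes at times
        later than \<open>t\<close>, which resampling at \<open>t\<close> leaves alone.\<close>
      have "free n (quot (reversed n (w(t := v)))) ?t = free n (quot (reversed n w)) ?t"
        using t by (intro free_cong) (auto simp: quot_def reversed_def)
      moreover have "quot (reversed n (w(t := v))) ?t = v div (n - t)"
        using t assms(2) by (auto simp: quot_def reversed_def)
      ultimately show "(slot n (quot (reversed n (w(t := v)))) ?t < p) = (v div (n - t) < ?y)"
        using slot_less_iff[of n "quot (reversed n (w(t := v)))" ?t p]
          quot_less[OF reversed_codes[OF w']] t(1) by simp
    qed
    ultimately have "average {..<Suc t * (n - t)} (\<lambda>v. of_bool ((slot n (quot (w(t := v))) t < p) \<noteq>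
          (slot n (quot (reversed n (w(t := v)))) ?t < p))) =
        average {..<Suc t * (n - t)} (\<lambda>v. of_bool ((v div Suc t < ?x) \<noteq> (v div (n - t) < ?y)))"
      by (intro average_cong) (simp del: mult_Suc)
    also have "\<dots> = \<bar>real ?x / real (n - t) - real ?y / real (Suc t)\<bar>"
      using \<open>?x \<le> n - t\<close> \<open>?y \<le> Suc t\<close> assms(2) by (intro average_div_less_neq) auto
    finally show "average {..<Suc t * (n - t)} (\<lambda>v. of_bool ((slot n (quot (w(t := v))) t < p) \<noteq>
          (slot n (quot (reversed n (w(t := v)))) ?t < p))) =
        \<bar>low_fraction n p t w - low_fraction n p ?t (reversed n w)\<bar>"
      unfolding low_fraction_def t(2) .
  qed
  also have "\<dots> \<le> average (codes n) (\<lambda>w. \<bar>low_fraction n p t w - ?c\<bar> +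
      \<bar>low_fraction n p ?t (reversed n w) - ?c\<bar>)"
    by (intro average_mono) simp
  \<comment> \<open>The reversed code is again uniform, so the backward fraction deviates on average
    as much as the forward one at time \<open>?t\<close>.\<close>
  also have "\<dots> = average (codes n) (\<lambda>w. \<bar>low_fraction n p t w - ?c\<bar>) +
      average (codes n) (\<lambda>w. \<bar>low_fraction n p ?t w - ?c\<bar>)"
    unfolding average_add
    by (simp only: average_reindex[OF bij_betw_reversed, where f = "\<lambda>w. \<bar>low_fraction n p ?t w - ?c\<bar>"])
  also have "\<dots> \<le> 1 / sqrt (real (n - t)) + 1 / sqrt (real (Suc t))"
    using low_fraction_deviation[of p n t] low_fraction_deviation[of p n ?t] assms t
    by (intro add_mono) auto
  finally show ?thesis .
qed

section \<open>Summation over times and thresholds\<close>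

text \<open>Telescoping: \<open>1 / ?b\<close> is at most \<open>2 * (?b - ?a)\<close>, since the
  gap is the nonnegative \<open>(?b - ?a)\<^sup>2 / ?b\<close>.\<close>

lemma sum_inverse_sqrt: "(\<Sum>t<n. 1 / sqrt (real (Suc t))) \<le> 2 * sqrt (real n)"
proof (induction n)
  case (Suc n)
  let ?a = "sqrt (real n)" and ?b = "sqrt (real (Suc n))"
  have b: "?b > 0" "?b\<^sup>2 = ?a\<^sup>2 + 1"
    by simp_all
  have "0 \<le> (?b - ?a)\<^sup>2 / ?b"
    using b by simp
  also have "\<dots> = 2 * ?b - 2 * ?a - 1 / ?b"
    using b by (simp add: field_simps power2_eq_square)
  finally show ?case
    using Suc by simp
qed simp

text \<open>Layer-cake form of a distance: the separating thresholds run from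
  \<open>min a b + 1\<close> to \<open>max a b\<close>, all of them below \<open>n\<close>.\<close>

lemma card_threshold_neq:
  assumes "a < n" "b < n"
  shows "(\<Sum>p<n. of_bool ((a < p) \<noteq> (b < p))) = \<bar>real a - real b\<bar>"
proof -
  have "{..<n} \<inter> {p. (a < p) \<noteq> (b < p)} = {Suc (min a b)..<Suc (max a b)}"
    using assms by auto
  then have "(\<Sum>p<n. of_bool ((a < p) \<noteq> (b < p))) = real (max a b - min a b)"
    by (simp add: sum.If_cases of_bool_def)
  then show ?thesis
    by (simp add: of_nat_diff max_def min_def)
qed

lemma average_footrule:
  "average (codes n) (\<lambda>w. \<Sum>t<n. \<bar>real (slot n (quot w) t) -
      real (slot n (quot (reversed n w)) (n - 1 - t))\<bar>) \<le> 4 * (real n * sqrt (real n))"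
proof -
  have "average (codes n) (\<lambda>w. \<Sum>t<n. \<bar>real (slot n (quot w) t) -
        real (slot n (quot (reversed n w)) (n - 1 - t))\<bar>) =
      average (codes n) (\<lambda>w. \<Sum>t<n. \<Sum>p<n. of_bool ((slot n (quot w) t < p) \<noteq>
        (slot n (quot (reversed n w)) (n - 1 - t) < p)))"
    using quot_less reversed_codes
    by (intro average_cong sum.cong card_threshold_neq[symmetric] slot_less) auto
  also have "\<dots> = (\<Sum>t<n. \<Sum>p<n. average (codes n) (\<lambda>w. of_bool ((slot n (quot w) t < p) \<noteq>
        (slot n (quot (reversed n w)) (n - 1 - t) < p))))"
    by (simp only: average_sum)
  also have "\<dots> \<le> (\<Sum>t<n. \<Sum>p<n. 1 / sqrt (real (n - t)) + 1 / sqrt (real (Suc t)))"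
    by (intro sum_mono average_crossing) auto
  also have "\<dots> = real n * ((\<Sum>t<n. 1 / sqrt (real (n - t))) + (\<Sum>t<n. 1 / sqrt (real (Suc t))))"
    by (simp add: sum.distrib sum_distrib_left[symmetric])
  also have "(\<Sum>t<n. 1 / sqrt (real (n - t))) = (\<Sum>t<n. 1 / sqrt (real (Suc t)))"
    by (subst sum.nat_diff_reindex[symmetric]) (intro sum.cong, auto simp: Suc_diff_Suc)
  also have "real n * ((\<Sum>t<n. 1 / sqrt (real (Suc t))) + (\<Sum>t<n. 1 / sqrt (real (Suc t)))) \<le>
      real n * (2 * sqrt (real n) + 2 * sqrt (real n))"
    by (intro mult_left_mono add_mono sum_inverse_sqrt) auto
  finally show ?thesis
    by (simp add: algebra_simps)
qed

subsection \<open>The algorithm\<close>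

text \<open>The Lehmer code of the arrival order: the 0-based relative rank of arrival
  \<open>t\<close> among the arrivals so far.\<close>

definition digit :: "'a::linorder list \<Rightarrow> nat \<Rightarrow> nat" where
  "digit xs t = card {j. j < t \<and> xs ! j < xs ! t}"

text \<open>The relative rank and the noise at time \<open>t\<close> are the two digits of one number, which is uniform
  below \<open>Suc t * (n - t)\<close>. Dividing it by \<open>n - t\<close> returns the relative rank, dividing it by \<open>Suc t\<close>
  gives the index of the chosen free position.\<close>

definition encode :: "nat \<Rightarrow> 'a::linorder list \<times> (nat \<Rightarrow> nat) \<Rightarrow> nat \<Rightarrow> nat" where
  "encode n = (\<lambda>(xs, u). \<lambda>t\<in>{..<n}. digit xs t * (n - t) + u t)"

definition noise :: "nat \<Rightarrow> (nat \<Rightarrow> nat) set" where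
  "noise n = (\<Pi>\<^sub>E t\<in>{..<n}. {..<n - t})"

text \<open>All earlier indices are recomputed from \<open>R\<close>. For \<open>i > t\<close> the
  comparisons are missing and the index is meaningless, but \<open>slot\<close> at \<open>t\<close>
  reads only \<open>i \<le> t\<close>. The outer \<open>Suc\<close> passes to positions counted from
  1.\<close>

definition rule :: "nat \<Rightarrow> (nat \<Rightarrow> nat) \<Rightarrow> online_rule" where
  "rule n u t R = Suc (slot n
     (\<lambda>i. (card {j. j < i \<and> (j, i) \<in> R} * (n - i) + u i) div Suc i) t)"

lemma digit_le: "digit xs t \<le> t"
proof -
  have "digit xs t \<le> card {..<t}"
    unfolding digit_def by (intro card_mono) auto
  then show ?thesis
    by simp
qed

lemma digit_eq_below:
  assumes "distinct xs" "t < length xs"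
  shows "digit xs t = below (set (take (Suc t) xs)) (xs ! t)"
proof -
  have "set (take (Suc t) xs) = (!) xs ` {0..<Suc t}"
    using assms by (intro nth_image[symmetric]) simp
  then have "{y \<in> set (take (Suc t) xs). y < xs ! t} = (!) xs ` {j. j < t \<and> xs ! j < xs ! t}"
    by (auto simp: less_Suc_eq)
  moreover have "inj_on ((!) xs) {j. j < t \<and> xs ! j < xs ! t}"
    using assms by (intro inj_on_nth) auto
  ultimately show ?thesis
    by (simp add: below_def digit_def card_image)
qed

lemma encode_in_codes:
  assumes "u \<in> noise n"
  shows "encode n (xs, u) \<in> codes n"
proof -
  have "digit xs t * (n - t) + u t < Suc t * (n - t)" if "t < n" for t
  proof -
    have "u t < n - t"
      using assms that by (auto simp: noise_def)
    moreover have "digit xs t * (n - t) \<le> t * (n - t)"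
      by (intro mult_right_mono digit_le) simp
    ultimately have "digit xs t * (n - t) + u t < t * (n - t) + (n - t)"
      by (rule add_le_less_mono[rotated])
    then show ?thesis
      by (simp only: mult_Suc add.commute)
  qed
  then show ?thesis
    by (simp add: encode_def codes_def del: mult_Suc)
qed

lemma encode_div_mod:
  assumes "u \<in> noise n" "t < n"
  shows "encode n (xs, u) t div (n - t) = digit xs t" "encode n (xs, u) t mod (n - t) = u t"
proof -
  have "u t < n - t"
    using assms by (auto simp: noise_def)
  then show "encode n (xs, u) t div (n - t) = digit xs t" "encode n (xs, u) t mod (n - t) = u t"
    using assms(2) by (simp_all add: encode_def)
qed

lemma assigned_position_rule:
  assumes "t < n" "n = length xs"
  shows "assigned_position (rule n u) xs t = Suc (slot n (quot (encode n (xs, u))) t)"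
proof -
  have "{j. j < i \<and> (j, i) \<in> comparisons (take (Suc t) xs)} = {j. j < i \<and> xs ! j < xs ! i}"
    if "i \<le> t" for i
    using that assms by (auto simp: comparisons_def)
  then show ?thesis
    unfolding assigned_position_def rule_def using assms(1)
    by (auto simp: quot_def encode_def digit_def intro!: slot_cong)
qed

section \<open>Duality of ranks and positions\<close>

text \<open>Passing to true ranks preserves the order, so the relative rank of an arrival is also
  the index of its true rank among those of the arrivals so far. This is one step of decoding the
  Lehmer code from its end.\<close>

lemma nth_least_prefix:
  assumes "finite S" "xs \<in> permutations_of_set S" "t < card S"
  shows "nth_least (below S ` set (take (Suc t) xs)) (digit xs t) = below S (xs ! t)"
proof -
  have xs: "distinct xs" "length xs = card S" "set xs = S"
    using permutations_of_setD[OF assms(2)] length_finite_permutations_of_set[OF assms(2)] by auto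
  let ?T = "set (take (Suc t) xs)"
  have T: "?T \<subseteq> S" "xs ! t \<in> ?T"
    using xs assms(3) set_take_subset[of "Suc t" xs] by (auto simp: take_Suc_conv_app_nth)
  have "strict_mono_on ?T (below S)"
    using T(1) below_less_iff[OF assms(1)] by (auto intro!: strict_mono_onI)
  then have "digit xs t = below (below S ` ?T) (below S (xs ! t))"
    using below_image[of ?T "below S" "xs ! t"] T(2) digit_eq_below[of xs t] xs assms(3) by simp
  then show ?thesis
    using T(2) by (simp add: nth_least_below)
qed

lemma quot_reversed_encode:
  assumes "u \<in> noise n" "t < n"
  shows "quot (reversed n (encode n (xs, u))) (n - 1 - t) = digit xs t"
  using encode_div_mod(1)[OF assms, of xs] assms(2)
  by (simp add: quot_def reversed_def Suc_diff_Suc)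

text \<open>Induction on backward time: by \<open>nth_least_prefix\<close>, each step removes the
  true rank of the latest arrival that remains.\<close>

lemma free_reversed_encode:
  assumes "finite S" "xs \<in> permutations_of_set S" "u \<in> noise (card S)" "s \<le> card S"
  shows "free (card S) (quot (reversed (card S) (encode (card S) (xs, u)))) s =
    below S ` set (take (card S - s) xs)"
  using assms(4)
proof (induction s)
  case 0
  have "set (take (card S) xs) = S"
    using permutations_of_setD[OF assms(2)] length_finite_permutations_of_set[OF assms(2)] by simp
  then show ?case
    using bij_betw_below[OF assms(1)] by (simp add: bij_betw_def)
next
  case (Suc s)
  define t where "t = card S - Suc s"
  have xs: "distinct xs" "length xs = card S" "set xs = S"
    using permutations_of_setD[OF assms(2)] length_finite_permutations_of_set[OF assms(2)] by auto
  have t: "t < card S" "card S - s = Suc t" "s = card S - 1 - t"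
    using Suc.prems by (auto simp: t_def)
  have inj: "inj_on (below S) S"
    using bij_betw_below[OF assms(1)] by (rule bij_betw_imp_inj_on)
  have take: "set (take (Suc t) xs) = insert (xs ! t) (set (take t xs))"
    using xs t(1) by (simp add: take_Suc_conv_app_nth)
  have notin: "xs ! t \<notin> set (take t xs)"
    using xs t(1) distinct_take[of xs "Suc t"] by (simp add: take_Suc_conv_app_nth)
  have "free (card S) (quot (reversed (card S) (encode (card S) (xs, u)))) (Suc s) =
      below S ` set (take (Suc t) xs) - {below S (xs ! t)}"
    using Suc quot_reversed_encode[OF assms(3) t(1), of xs] nth_least_prefix[OF assms(1,2) t(1)] t
    by simp
  also have "\<dots> = below S ` (set (take (Suc t) xs) - {xs ! t})"
    using inj_on_image_set_diff[OF inj, of "set (take (Suc t) xs)" "{xs ! t}"]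
      set_take_subset[of "Suc t" xs] xs(3) take by auto
  also have "set (take (Suc t) xs) - {xs ! t} = set (take t xs)"
    using take notin by auto
  finally show ?case
    by (simp add: t_def)
qed

text \<open>Duality: read backwards in time, the true ranks arise from the relative ranks by the same
  removal process that produces the positions.\<close>

lemma slot_reversed_encode:
  assumes "finite S" "xs \<in> permutations_of_set S" "u \<in> noise (card S)" "t < card S"
  shows "slot (card S) (quot (reversed (card S) (encode (card S) (xs, u)))) (card S - 1 - t) =
    below S (xs ! t)"
proof -
  have "card S - (card S - 1 - t) = Suc t"
    using assms(4) by simp
  then show ?thesis
    using free_reversed_encode[OF assms(1-3), of "card S - 1 - t"]
      quot_reversed_encode[OF assms(3,4), of xs] nth_least_prefix[OF assms(1,2,4)]
    by (simp add: slot_def)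
qed

text \<open>A uniform order with independent noise thus becomes a uniform code. Remainders recover
  the noise and duality recovers the order, which gives injectivity; surjectivity follows by
  counting, as both sides have \<open>(fact n)\<^sup>2\<close> elements for
  \<open>n = card S\<close>.\<close>

lemma bij_betw_encode:
  assumes "finite S"
  shows "bij_betw (encode (card S)) (permutations_of_set S \<times> noise (card S)) (codes (card S))"
proof -
  let ?n = "card S"
  have inj: "inj_on (encode ?n) (permutations_of_set S \<times> noise ?n)"
  proof (rule inj_onI, clarify)
    fix xs ys :: "'a list" and u v
    assume xs: "xs \<in> permutations_of_set S" and ys: "ys \<in> permutations_of_set S"
      and u: "u \<in> noise ?n" and v: "v \<in> noise ?n" and eq: "encode ?n (xs, u) = encode ?n (ys, v)"
    have "u t = v t" if "t \<in> {..<?n}" for t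
      using encode_div_mod(2)[OF u, of t xs] encode_div_mod(2)[OF v, of t ys] that eq by simp
    then have "u = v"
      using u v unfolding noise_def by (intro PiE_ext)
    moreover have "xs = ys"
    proof (rule nth_equalityI)
      show "length xs = length ys"
        using xs ys by (simp add: length_finite_permutations_of_set)
      fix t assume "t < length xs"
      then have t: "t < ?n" "xs ! t \<in> S" "ys ! t \<in> S"
        using xs ys permutations_of_setD length_finite_permutations_of_set by (metis nth_mem)+
      then have "below S (xs ! t) = below S (ys ! t)"
        using slot_reversed_encode[OF assms xs u t(1)] slot_reversed_encode[OF assms ys v t(1)] eq
        by simp
      then show "xs ! t = ys ! t"
        using bij_betw_imp_inj_on[OF bij_betw_below[OF assms]] t by (auto dest: inj_onD)
    qed
    ultimately show "xs = ys \<and> u = v"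
      by simp
  qed
  have "(\<Prod>t<?n. Suc t * (?n - t)) = (\<Prod>t<?n. Suc t) * (\<Prod>t<?n. ?n - t)"
    by (rule prod.distrib)
  then have "card (permutations_of_set S \<times> noise ?n) = card (codes ?n)"
    using assms by (simp add: card_cartesian_product noise_def codes_def card_PiE
        fact_prod_Suc lessThan_atLeast0 del: mult_Suc)
  moreover have "encode ?n ` (permutations_of_set S \<times> noise ?n) \<subseteq> codes ?n"
    using encode_in_codes by auto
  ultimately show ?thesis
    using inj finite_codes by (metis bij_betw_def card_image card_subset_eq)
qed

text \<open>A pair with \<open>b i < b j\<close> and \<open>a j < a i\<close> is charged to \<open>i\<close> if \<open>b j \<le> a i\<close>, and to \<open>j\<close>
  otherwise.\<close>

lemma card_inversions_le_footrule:
  fixes a b :: "nat \<Rightarrow> nat"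
  assumes a: "inj_on a {..<n}" and b: "inj_on b {..<n}"
  shows "real (card {(i, j). i < n \<and> j < n \<and> (int (a i) - int (a j)) * (int (b i) - int (b j)) < 0})
    \<le> 2 * (\<Sum>i<n. \<bar>real (a i) - real (b i)\<bar>)"
proof -
  define P where "P = {(i, j). i < n \<and> j < n \<and> a j < a i \<and> b i < b j}"
  have fin: "finite P"
    by (rule finite_subset[of _ "{..<n} \<times> {..<n}"]) (auto simp: P_def)
  have "P \<subseteq> (SIGMA i:{..<n}. {j. j < n \<and> b i < b j \<and> b j \<le> a i}) \<union>
      prod.swap ` (SIGMA j:{..<n}. {i. i < n \<and> a j < a i \<and> a i \<le> b j})"
    by (fastforce simp: P_def image_iff)
  then have "card P \<le> card ((SIGMA i:{..<n}. {j. j < n \<and> b i < b j \<and> b j \<le> a i}) \<union>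
      prod.swap ` (SIGMA j:{..<n}. {i. i < n \<and> a j < a i \<and> a i \<le> b j}))"
    by (intro card_mono) auto
  also have "\<dots> \<le> card (SIGMA i:{..<n}. {j. j < n \<and> b i < b j \<and> b j \<le> a i}) +
      card (prod.swap ` (SIGMA j:{..<n}. {i. i < n \<and> a j < a i \<and> a i \<le> b j}))"
    by (rule card_Un_le)
  also have "\<dots> \<le> (\<Sum>i<n. card {j. j < n \<and> b i < b j \<and> b j \<le> a i}) +
      (\<Sum>i<n. card {j. j < n \<and> a i < a j \<and> a j \<le> b i})"
    by (intro add_mono order.trans[OF card_image_le]) (auto simp: card_SigmaI)
  also have "\<dots> \<le> (\<Sum>i<n. a i - b i) + (\<Sum>i<n. b i - a i)"
  proof (intro add_mono sum_mono)
    fix i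
    have *: "card {j. j < n \<and> d i < d j \<and> d j \<le> c i} \<le> c i - d i" if "inj_on d {..<n}"
      for c d :: "nat \<Rightarrow> nat"
    proof -
      have "inj_on d {j. j < n \<and> d i < d j \<and> d j \<le> c i}"
        using that by (rule inj_on_subset) auto
      then have "card {j. j < n \<and> d i < d j \<and> d j \<le> c i} \<le> card {d i<..c i}"
        by (rule card_inj_on_le) auto
      then show ?thesis
        by simp
    qed
    show "card {j. j < n \<and> b i < b j \<and> b j \<le> a i} \<le> a i - b i"
      "card {j. j < n \<and> a i < a j \<and> a j \<le> b i} \<le> b i - a i"
      using *[OF b] *[OF a] by auto
  qed
  finally have "real (card P) \<le> real ((\<Sum>i<n. a i - b i) + (\<Sum>i<n. b i - a i))"
    by (rule of_nat_mono)
  \<comment> \<open>At most one of the two truncated differences is nonzero, so they add up to the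
    absolute difference.\<close>
  also have "\<dots> = (\<Sum>i<n. real (a i - b i) + real (b i - a i))"
    by (simp add: sum.distrib)
  also have "\<dots> = (\<Sum>i<n. \<bar>real (a i) - real (b i)\<bar>)"
    by (intro sum.cong refl) linarith
  finally have P: "real (card P) \<le> (\<Sum>i<n. \<bar>real (a i) - real (b i)\<bar>)" .
  \<comment> \<open>Each discordant pair occurs in both orders, whence the factor 2.\<close>
  have "{(i, j). i < n \<and> j < n \<and> (int (a i) - int (a j)) * (int (b i) - int (b j)) < 0} =
      P \<union> prod.swap ` P"
    by (auto simp: P_def mult_less_0_iff image_iff)
  then have "card {(i, j). i < n \<and> j < n \<and> (int (a i) - int (a j)) * (int (b i) - int (b j)) < 0}
      \<le> card P + card P"
    using card_Un_le[of P "prod.swap ` P"] card_image_le[OF fin, of prod.swap] by simp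
  then show ?thesis
    using P by linarith
qed

section \<open>Validity and expected cost of the algorithm\<close>

lemma inversions_rule_le:
  assumes "finite S" "xs \<in> permutations_of_set S" "u \<in> noise (card S)"
  defines "w \<equiv> encode (card S) (xs, u)"
  shows "real (inversions (rule (card S) u) xs) \<le> 2 * (\<Sum>t<card S. \<bar>real (slot (card S) (quot w) t) -
    real (slot (card S) (quot (reversed (card S) w)) (card S - 1 - t))\<bar>)"
proof -
  let ?n = "card S"
  let ?a = "assigned_position (rule ?n u) xs" and ?b = "\<lambda>t. rk S (xs ! t)"
  have xs: "distinct xs" "length xs = ?n" "set xs = S"
    using permutations_of_setD[OF assms(2)] length_finite_permutations_of_set[OF assms(2)] by auto
  have w: "w \<in> codes ?n"
    unfolding w_def using assms(3) by (rule encode_in_codes)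
  have a: "?a t = Suc (slot ?n (quot w) t)" if "t < ?n" for t
    unfolding w_def using that xs(2)[symmetric] by (rule assigned_position_rule)
  have b: "?b t = Suc (slot ?n (quot (reversed ?n w)) (?n - 1 - t))" if "t < ?n" for t
  proof -
    have "xs ! t \<in> S"
      using nth_mem[of t xs] that xs(2,3) by simp
    then show ?thesis
      using slot_reversed_encode[OF assms(1-3) that] rk_eq_Suc_below[OF assms(1)] by (simp add: w_def)
  qed
  have "inj_on ?a {..<?n}"
    using inj_on_slot[of ?n "quot w"] quot_less[OF w] a by (auto simp: inj_on_def)
  moreover have "inj_on ?b {..<?n}"
  proof (rule inj_onI)
    fix i j assume ij: "i \<in> {..<?n}" "j \<in> {..<?n}" "?b i = ?b j"
    have "inj_on (slot ?n (quot (reversed ?n w))) {..<?n}"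
      using quot_less[OF reversed_codes[OF w]] by (rule inj_on_slot)
    then have "?n - 1 - i = ?n - 1 - j"
      by (rule inj_onD) (use ij b in auto)
    then show "i = j"
      using ij by auto
  qed
  ultimately have "real (inversions (rule ?n u) xs) \<le> 2 * (\<Sum>t<?n. \<bar>real (?a t) - real (?b t)\<bar>)"
    unfolding inversions_def xs(2,3) by (rule card_inversions_le_footrule)
  \<comment> \<open>Positions and ranks both carry a \<open>Suc\<close>, which cancels in the
    differences.\<close>
  also have "(\<Sum>t<?n. \<bar>real (?a t) - real (?b t)\<bar>) = (\<Sum>t<?n. \<bar>real (slot ?n (quot w) t) -
      real (slot ?n (quot (reversed ?n w)) (?n - 1 - t))\<bar>)"
    using a b by (intro sum.cong) auto
  finally show ?thesis .
qed

lemma finite_noise: "finite (noise n)"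
  unfolding noise_def by (intro finite_PiE) auto

lemma noise_nonempty: "noise n \<noteq> {}"
  unfolding noise_def by (auto simp: PiE_eq_empty_iff lessThan_empty_iff)

definition algorithm :: "nat \<Rightarrow> randomized_rule" where
  "algorithm n = map_pmf (rule n) (pmf_of_set (noise n))"

lemma online_ranking_algorithm_algorithm:
  assumes "finite S"
  shows "online_ranking_algorithm (card S) S (algorithm (card S))"
  unfolding online_ranking_algorithm_def
proof (intro ballI allI impI)
  let ?n = "card S"
  fix f and xs :: "'a list" and t
  assume "f \<in> set_pmf (algorithm ?n)" and xs: "xs \<in> permutations_of_set S" and t: "t < ?n"
  then obtain u where u: "u \<in> noise ?n" "f = rule ?n u"
    by (auto simp: algorithm_def set_pmf_of_set finite_noise noise_nonempty)
  let ?k = "quot (encode ?n (xs, u))"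
  have k: "?k i < ?n - i" if "i < ?n" for i
    using quot_less[OF encode_in_codes[OF u(1)] that] .
  have pos: "assigned_position f xs i = Suc (slot ?n ?k i)" if "i < ?n" for i
    using assigned_position_rule[OF that, of xs u] length_finite_permutations_of_set[OF xs] u(2) by simp
  show "assigned_position f xs t \<in> {1..?n} - assigned_position f xs ` {..<t}"
    using pos t slot_less[of ?n ?k t, OF k t] slot_neq[of ?n ?k _ t, OF k _ t] by auto
qed

lemma expected_inversions_algorithm:
  assumes "finite S"
  shows "expected_inversions S (algorithm (card S)) =
    average (permutations_of_set S \<times> noise (card S)) (\<lambda>(xs, u). real (inversions (rule (card S) u) xs))"
proof -
  let ?n = "card S" and ?\<Omega> = "permutations_of_set S \<times> noise (card S)"
  have ne: "permutations_of_set S \<noteq> {}" "noise ?n \<noteq> {}"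
    using assms noise_nonempty by auto
  \<comment> \<open>Independent uniform choices are jointly uniform on the product.\<close>
  have pair: "pair_pmf (pmf_of_set (permutations_of_set S)) (pmf_of_set (noise ?n)) = pmf_of_set ?\<Omega>"
    using ne by (intro pmf_eqI)
      (auto simp: pmf_pair pmf_of_set indicator_def finite_noise noise_nonempty
        card_cartesian_product)
  have "pair_pmf (pmf_of_set (permutations_of_set S)) (algorithm ?n) =
      map_pmf (\<lambda>(xs, u). (xs, rule ?n u)) (pmf_of_set ?\<Omega>)"
    by (simp add: algorithm_def pair_map_pmf2 pair apsnd_def map_prod_def)
  then have "expected_inversions S (algorithm ?n) = measure_pmf.expectation (pmf_of_set ?\<Omega>)
      (\<lambda>(xs, u). real (inversions (rule ?n u) xs))"
    by (simp add: expected_inversions_def case_prod_unfold)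
  also have "\<dots> = average ?\<Omega> (\<lambda>(xs, u). real (inversions (rule ?n u) xs))"
    using ne by (subst integral_pmf_of_set) (auto simp: average_def finite_noise)
  finally show ?thesis .
qed

theorem theorem3p1:
  "\<exists>A :: nat \<Rightarrow> randomized_rule. \<exists>C :: real.
     \<forall>S :: 'a::linorder set. finite S \<longrightarrow>
       online_ranking_algorithm (card S) S (A (card S)) \<and>
       expected_inversions S (A (card S)) \<le> C * (real (card S) * sqrt (real (card S)))"
proof (intro exI[of _ algorithm] exI[of _ 8] allI impI conjI)
  fix S :: "'a set"
  assume S: "finite S"
  then show "online_ranking_algorithm (card S) S (algorithm (card S))"
    by (rule online_ranking_algorithm_algorithm)
  let ?n = "card S" and ?\<Omega> = "permutations_of_set S \<times> noise (card S)"
  let ?D = "\<lambda>w. \<Sum>t<?n. \<bar>real (slot ?n (quot w) t) - real (slot ?n (quot (reversed ?n w)) (?n - 1 - t))\<bar>"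
  have "expected_inversions S (algorithm ?n) \<le> average ?\<Omega> (\<lambda>x. 2 * ?D (encode ?n x))"
    unfolding expected_inversions_algorithm[OF S]
    using inversions_rule_le[OF S] by (intro average_mono) auto
  also have "\<dots> = 2 * average (codes ?n) ?D"
    by (simp only: average_cmult average_reindex[OF bij_betw_encode[OF S], of ?D])
  \<comment> \<open>The constant 8 arises as 2 from counting ordered pairs times 4 from the footrule
    bound.\<close>
  also have "\<dots> \<le> 2 * (4 * (real ?n * sqrt (real ?n)))"
    by (intro mult_left_mono average_footrule) simp
  finally show "expected_inversions S (algorithm ?n) \<le> 8 * (real ?n * sqrt (real ?n))"
    by simp
qed

end
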